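(* Suppose that for each state $i=1,\dots,m$: (a) $U_i(u,t)$ is monotonically increasing in $u$ and $t$, $\lim_{t\to+\infty}U_i(u,t)=+\infty$ for every $u\ge 0$, and $U_i(u,t)\ge u+c_it$ for all $u\ge u_*$, $t\ge 0$, with some constants $c_i\ge0$ and $u_*\ge0$ ($u_*$ common to all $i$); (b) $\alpha_i\mu_i/c_i<1$, and there is a constant $L>0$, common to all states, such that $(\alpha_i/c_i)\int_0^{+\infty}e^{Lz}[1-F_i(z)]\,dz\le1$. Put $\varphi_*(u)=\max\{0,1-e^{-L(u-u_* )}\}$. Consider the system $$\varphi_i(u)=\int_0^\infty e^{-t(\alpha_i+\lambda_i)}\Big\{\lambda_i\sum_{j=1}^mp_{ij}\varphi_j(U_i(u,t))+\alpha_i\int_0^{U_i(u,t)}\varphi_i(U_i(u,t)-z)\,dF_i(z)\Big\}dt,\quad i=1,\dots,m,\qquad(\mathrm S)$$ with boundary conditions $\lim_{u\to+\infty}\varphi_i(u)=1$, $i=1,\dots,m$, and the successive approximations $\varphi_i^{k+1}(u)$, $k=0,1,\dots$, obtained by substituting $\varphi^k_1,\dots,\varphi^k_m$ for $\varphi_1,\dots,\varphi_m$ in the right-hand side of (S). Then: 1) the system (S) with the boundary conditions has a solution with nondecreasing components $\varphi_i$ such that $1\ge\varphi_i(u)\ge\varphi_*(u)$ for all $u\ge0$, $i=1,\dots,m$; 2) such a solution is unique; 3) the approximations started from $\varphi_i^0\equiv1$ ($i=1,\dots,m$) converge monotonically from above, and those started from $\varphi_i^0=\varphi_*$ ($i=1,\dots,m$)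 converge monotonically from below, pointwise, to the solution $\varphi_i(u)$ for each $i$; 4) for any initial approximation with $1\ge\varphi_i^0(u)\ge\varphi_*(u)$ for all $u\ge0$, $i=1,\dots,m$, the approximations converge pointwise to the solution $\{\varphi_i(u)\}$.
   Context: $\alpha_i>0$, $\lambda_i>0$; $p_{ij}\ge0$, $p_{ii}=0$, $\sum_{j=1}^mp_{ij}=1$ for $i=1,\dots,m$. $F_i$ are distribution functions of claims with $F_i(z)=0$ for $z\le0$ and finite means $\mu_i$. $U_i(u,t)\ge 0$, $u,t\ge0$, is the reserve growth function in environment state $i$ with $U_i(u,0)=u$ (the solution of a Cauchy problem $dU_i/dt=c_i(U_i)$, $U_i(u,0)=u$, in particular continuous in $t$; the function $c_i(\cdot)$ here is distinct from the constant $c_i$ in hypothesis (a)). Inner integrals are Lebesgue–Stieltjes integrals over $[0,U_i(u,t)]$. All initial functions are Borel measurable. *)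

theory Defs
  imports "HOL-Probability.Probability"
begin

definition distribution_function :: "(real \<Rightarrow> real) \<Rightarrow> bool" where
  "distribution_function F \<longleftrightarrow>
     mono F \<and> (\<forall>x. continuous (at_right x) F) \<and>
     (F \<longlongrightarrow> 0) at_bot \<and> (F \<longlongrightarrow> 1) at_top"

definition df_mean :: "(real \<Rightarrow> real) \<Rightarrow> real" where
  "df_mean F = (LINT z|interval_measure F. z)"

definition reserve_growth :: "(real \<Rightarrow> real) \<Rightarrow> (real \<Rightarrow> real \<Rightarrow> real) \<Rightarrow> bool" where
  "reserve_growth r U \<longleftrightarrow>
     (\<forall>u\<ge>0. U u 0 = u \<and>
       (\<forall>t\<ge>0. U u t \<ge> 0 \<and>
         (U u has_real_derivative r (U u t)) (at t within {0..})))"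

text \<open>
  Functions on \<open>[0, \<infinity>)\<close> are represented by total functions on the reals. For \<open>u \<ge> 0\<close> the
  operator below uses only the values of \<open>\<phi>\<close> at nonnegative arguments, provided \<open>U\<close> is
  nonnegative there. The inner integral is the Lebesgue-Stieltjes integral over the closed
  interval, with respect to the measure generated by \<open>F i\<close>.
\<close>

definition risk_operator ::
  "('i::finite \<Rightarrow> real) \<Rightarrow> ('i \<Rightarrow> real) \<Rightarrow> ('i \<Rightarrow> 'i \<Rightarrow> real) \<Rightarrow> ('i \<Rightarrow> real \<Rightarrow> real) \<Rightarrow>
   ('i \<Rightarrow> real \<Rightarrow> real \<Rightarrow> real) \<Rightarrow> ('i \<Rightarrow> real \<Rightarrow> real) \<Rightarrow> 'i \<Rightarrow> real \<Rightarrow> real" where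
  "risk_operator \<alpha> lam p F U \<phi> i u =
     (LBINT t:{0..}. exp (- t * (\<alpha> i + lam i)) *
        (lam i * (\<Sum>j\<in>UNIV. p i j * \<phi> j (U i u t)) +
         \<alpha> i * (LINT z:{0..U i u t}|interval_measure (F i). \<phi> i (U i u t - z))))"

definition risk_solution ::
  "('i::finite \<Rightarrow> real) \<Rightarrow> ('i \<Rightarrow> real) \<Rightarrow> ('i \<Rightarrow> 'i \<Rightarrow> real) \<Rightarrow> ('i \<Rightarrow> real \<Rightarrow> real) \<Rightarrow>
   ('i \<Rightarrow> real \<Rightarrow> real \<Rightarrow> real) \<Rightarrow> ('i \<Rightarrow> real \<Rightarrow> real) \<Rightarrow> bool" where
  "risk_solution \<alpha> lam p F U \<phi> \<longleftrightarrow>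
     (\<forall>i. \<forall>u\<ge>0. \<phi> i u = risk_operator \<alpha> lam p F U \<phi> i u) \<and>
     (\<forall>i. (\<phi> i \<longlongrightarrow> 1) at_top)"

definition phi_lower :: "real \<Rightarrow> real \<Rightarrow> real \<Rightarrow> real" where
  "phi_lower L ustar u = max 0 (1 - exp (- L * (u - ustar)))"

definition between_bounds :: "real \<Rightarrow> real \<Rightarrow> ('i \<Rightarrow> real \<Rightarrow> real) \<Rightarrow> bool" where
  "between_bounds L ustar \<phi> \<longleftrightarrow>
     (\<forall>i. \<forall>u\<ge>0. phi_lower L ustar u \<le> \<phi> i u \<and> \<phi> i u \<le> 1)"

definition admissible_solution ::
  "('i::finite \<Rightarrow> real) \<Rightarrow> ('i \<Rightarrow> real) \<Rightarrow> ('i \<Rightarrow> 'i \<Rightarrow> real) \<Rightarrow> ('i \<Rightarrow> real \<Rightarrow> real) \<Rightarrow>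
   ('i \<Rightarrow> real \<Rightarrow> real \<Rightarrow> real) \<Rightarrow> real \<Rightarrow> real \<Rightarrow> ('i \<Rightarrow> real \<Rightarrow> real) \<Rightarrow> bool" where
  "admissible_solution \<alpha> lam p F U L ustar \<phi> \<longleftrightarrow>
     risk_solution \<alpha> lam p F U \<phi> \<and> (\<forall>i. mono_on {0..} (\<phi> i)) \<and> between_bounds L ustar \<phi>"

definition approximation ::
  "('i::finite \<Rightarrow> real) \<Rightarrow> ('i \<Rightarrow> real) \<Rightarrow> ('i \<Rightarrow> 'i \<Rightarrow> real) \<Rightarrow> ('i \<Rightarrow> real \<Rightarrow> real) \<Rightarrow>
   ('i \<Rightarrow> real \<Rightarrow> real \<Rightarrow> real) \<Rightarrow> ('i \<Rightarrow> real \<Rightarrow> real) \<Rightarrow> nat \<Rightarrow> 'i \<Rightarrow> real \<Rightarrow> real" where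
  "approximation \<alpha> lam p F U \<phi>0 k = (risk_operator \<alpha> lam p F U ^^ k) \<phi>0"

end

theory Submission
  imports Defs "HOL-Real_Asymp.Real_Asymp"
begin

text \<open>
  The right-hand side of (S) is a monotone operator \<open>R\<close> on functions with values in \<open>[0, 1]\<close>, it
  preserves monotonicity in \<open>u\<close>, and \<open>R 1 \<le> 1\<close>. The exponential moment
  \<open>E exp (L Z) = 1 + L * (LBINT z:{0..}. exp (L * z) * (1 - F i z)) \<le> 1 + L * c i / \<alpha> i\<close>
  gives \<open>\<phi>\<^sub>* \<le> R \<phi>\<^sub>*\<close>. So the iterates from \<open>1\<close> decrease and those from \<open>\<phi>\<^sub>*\<close> increase, both to fixed
  points by dominated convergence. The difference of the two limits is a fixed point of the linear
  operator \<open>R\<close> that vanishes at infinity, and such a fixed point is zero. All other iterates and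
  all other solutions are squeezed between these two sequences.
\<close>

section \<open>Exponential integrals and measurability on half-lines\<close>

lemma
  fixes a T :: real
  assumes "a > 0"
  shows set_integrable_exp_minus_Ici: "set_integrable lborel {T..} (\<lambda>t. exp (- t * a))"
    and set_lebesgue_integral_exp_minus_Ici: "(LBINT t:{T..}. exp (- t * a)) = exp (- T * a) / a"
proof -
  have I: "((\<lambda>t. exp (- t * a)) has_integral exp (- T * a) / a) {T..}"
    using has_integral_exp_minus_to_infinity[OF assms, of T] by (simp add: mult.commute)
  \<comment> \<open>Nonnegativity upgrades gauge integrability to absolute integrability; Borel
    measurability then allows the passage from the completed measure to
    \<open>lborel\<close>.\<close>
  have "(\<lambda>t. exp (- t * a)) absolutely_integrable_on {T..}"
    using I by (intro nonnegative_absolutely_integrable_1) auto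
  then show *: "set_integrable lborel {T..} (\<lambda>t. exp (- t * a))"
    unfolding set_integrable_def by (subst (asm) integrable_completion) auto
  show "(LBINT t:{T..}. exp (- t * a)) = exp (- T * a) / a"
    using set_borel_integral_eq_integral(2)[OF *] integral_unique[OF I] by simp
qed

text \<open>Rounding \<open>t\<close> down to the grid of mesh \<open>1 / Suc n\<close> leaves
  countably many functions of \<open>u\<close>, one per grid value, so each approximant is jointly
  measurable; continuity in \<open>t\<close> makes the approximants converge pointwise.\<close>

lemma borel_measurable_pair_continuous_snd:
  fixes f :: "real \<Rightarrow> real \<Rightarrow> real"
  assumes meas: "\<And>t. (\<lambda>u. f u t) \<in> borel_measurable borel"
    and cont: "\<And>u t. isCont (f u) t"
  shows "(\<lambda>(u, t). f u t) \<in> borel_measurable (borel \<Otimes>\<^sub>M borel)"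
proof (rule borel_measurable_LIMSEQ_metric)
  define g where "g n x = f (fst x) (real_of_int \<lfloor>real (Suc n) * snd x\<rfloor> / real (Suc n))" for n and x :: "real \<times> real"
  show "g n \<in> borel_measurable (borel \<Otimes>\<^sub>M borel)" for n
  proof -
    have "(\<lambda>x. f (fst x) (real_of_int k / real (Suc n))) \<in> borel_measurable (borel \<Otimes>\<^sub>M borel)" for k :: int
      using measurable_compose[OF measurable_fst meas] by blast
    moreover have "(\<lambda>x :: real \<times> real. \<lfloor>real (Suc n) * snd x\<rfloor>) \<in> measurable (borel \<Otimes>\<^sub>M borel) (count_space UNIV)"
      by measurable
    ultimately show ?thesis
      unfolding g_def by (rule measurable_compose_countable)
  qed
  show "(\<lambda>n. g n x) \<longlonglongrightarrow> (case x of (u, t) \<Rightarrow> f u t)" for x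
  proof -
    have "(\<lambda>n. real_of_int \<lfloor>real (Suc n) * snd x\<rfloor> / real (Suc n)) \<longlonglongrightarrow> snd x"
    proof (rule tendsto_sandwich)
      show "\<forall>\<^sub>F n in sequentially. snd x - 1 / real (Suc n) \<le> real_of_int \<lfloor>real (Suc n) * snd x\<rfloor> / real (Suc n)"
      proof (intro always_eventually allI)
        fix n
        have "real (Suc n) * snd x - 1 \<le> real_of_int \<lfloor>real (Suc n) * snd x\<rfloor>"
          by linarith
        then have "(real (Suc n) * snd x - 1) / real (Suc n) \<le> real_of_int \<lfloor>real (Suc n) * snd x\<rfloor> / real (Suc n)"
          by (rule divide_right_mono) simp
        then show "snd x - 1 / real (Suc n) \<le> real_of_int \<lfloor>real (Suc n) * snd x\<rfloor> / real (Suc n)"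
          by (simp add: diff_divide_distrib del: of_nat_Suc)
      qed
      show "\<forall>\<^sub>F n in sequentially. real_of_int \<lfloor>real (Suc n) * snd x\<rfloor> / real (Suc n) \<le> snd x"
      proof (intro always_eventually allI)
        fix n
        have "real_of_int \<lfloor>real (Suc n) * snd x\<rfloor> \<le> real (Suc n) * snd x"
          by linarith
        then show "real_of_int \<lfloor>real (Suc n) * snd x\<rfloor> / real (Suc n) \<le> snd x"
          by (simp add: field_simps del: of_nat_Suc)
      qed
      have "(\<lambda>n. snd x - 1 / real (Suc n)) \<longlonglongrightarrow> snd x - 0"
        by (intro tendsto_intros LIMSEQ_Suc[OF lim_1_over_n])
      then show "(\<lambda>n. snd x - 1 / real (Suc n)) \<longlonglongrightarrow> snd x"
        by simp
    qed simp
    then show ?thesis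
      unfolding g_def using isCont_tendsto_compose[OF cont] by (simp add: case_prod_beta)
  qed
qed

lemma set_borel_measurable_mono_on_Ici:
  fixes f :: "real \<Rightarrow> real"
  assumes "mono_on {a..} f"
  shows "set_borel_measurable borel {a..} f"
proof -
  have "f \<in> borel_measurable (restrict_space borel {a..})"
    by (rule borel_measurable_mono_on_fnc[OF assms])
  then show ?thesis
    unfolding set_borel_measurable_def by (subst (asm) borel_measurable_restrict_space_iff) auto
qed

section \<open>Distribution functions and their exponential moments\<close>

lemma real_distribution_distribution_function:
  "distribution_function F \<Longrightarrow> real_distribution (interval_measure F)"
  unfolding distribution_function_def
  by (intro real_distribution_interval_measure) (auto simp: mono_def)

lemma cdf_distribution_function:
  "distribution_function F \<Longrightarrow> cdf (interval_measure F) = F"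
  unfolding distribution_function_def
  by (intro cdf_interval_measure) (auto simp: mono_def)

text \<open>Tonelli's theorem for \<open>exp (L * z) = 1 +\<close> the integral of
  \<open>L * exp (L * s)\<close> over \<open>0 \<le> s < z\<close>; this identity holds almost
  surely since \<open>cdf M 0 = 0\<close> puts all mass on positive \<open>z\<close>. Nonnegative
  integrals need no integrability in advance, and finiteness of the result supplies it at the
  end.\<close>

lemma (in real_distribution) exp_moment_tail:
  fixes L :: real
  assumes "L > 0"
    and supp: "cdf M 0 = 0"
    and int: "set_integrable lborel {0..} (\<lambda>z. exp (L * z) * (1 - cdf M z))"
  shows "integrable M (\<lambda>z. exp (L * z))"
    and "expectation (\<lambda>z. exp (L * z)) = 1 + L * (LBINT z:{0..}. exp (L * z) * (1 - cdf M z))"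
proof -
  let ?I = "LBINT z:{0..}. exp (L * z) * (1 - cdf M z)"
  have cdf_le: "cdf M z \<le> 1" for z
    using cdf_bounded_prob by blast
  have I_nonneg: "?I \<ge> 0"
    unfolding set_lebesgue_integral_def using cdf_le by (intro integral_nonneg_AE) auto
  have AE_pos: "AE z in M. 0 < z"
  proof (rule AE_I)
    show "emeasure M {..0} = 0"
      using supp by (simp add: cdf_def emeasure_eq_measure)
  qed (auto simp: not_less)
  interpret pair_sigma_finite M lborel ..
  have tail: "emeasure M {s<..} = ennreal (1 - cdf M s)" for s
  proof -
    have "{s<..} = space M - {..s}" by auto
    then have "prob {s<..} = 1 - cdf M s"
      using prob_compl[of "{..s}"] by (simp add: cdf_def)
    then show ?thesis by (simp add: emeasure_eq_measure)
  qed
  have FTC: "(\<integral>\<^sup>+s. ennreal (L * exp (L * s)) * indicator {0..z} s \<partial>lborel) = ennreal (exp (L * z) - 1)" if "z > 0" for z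
  proof -
    have "(\<integral>\<^sup>+s. ennreal (L * exp (L * s)) * indicator {0..z} s \<partial>lborel)
        = ennreal (exp (L * z) - exp (L * 0))"
      using that \<open>L > 0\<close> by (intro nn_integral_FTC_Icc) (auto intro!: derivative_eq_intros simp: mult_ac)
    then show ?thesis by simp
  qed
  have ex: "ennreal (exp (L * z)) = 1 + (\<integral>\<^sup>+s. ennreal (L * exp (L * s)) * indicator {0..} s * indicator {s<..} z \<partial>lborel)"
    if "z > 0" for z
  proof -
    have "(\<integral>\<^sup>+s. ennreal (L * exp (L * s)) * indicator {0..} s * indicator {s<..} z \<partial>lborel)
        = (\<integral>\<^sup>+s. ennreal (L * exp (L * s)) * indicator {0..z} s \<partial>lborel)"
    \<comment> \<open>The two domains \<open>0 \<le> s < z\<close> and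
      \<open>0 \<le> s \<le> z\<close> differ only in the null set \<open>s = z\<close>.\<close>
    proof (rule nn_integral_cong_AE, use AE_lborel_singleton[of z] in eventually_elim)
      case (elim s)
      then show ?case by (auto split: split_indicator)
    qed
    moreover have "ennreal (exp (L * z)) = 1 + ennreal (exp (L * z) - 1)"
      using that \<open>L > 0\<close> by (subst ennreal_1[symmetric], subst ennreal_plus[symmetric]) auto
    ultimately show ?thesis using FTC[OF that] by simp
  qed
  have [measurable]: "(\<lambda>(z, s). ennreal (L * exp (L * s)) * indicator {0..} s * indicator {s<..} z)
      \<in> borel_measurable (M \<Otimes>\<^sub>M lborel)"
    unfolding indicator_def by simp
  have "(\<integral>\<^sup>+z. ennreal (exp (L * z)) \<partial>M)
      = (\<integral>\<^sup>+z. 1 + (\<integral>\<^sup>+s. ennreal (L * exp (L * s)) * indicator {0..} s * indicator {s<..} z \<partial>lborel) \<partial>M)"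
    by (rule nn_integral_cong_AE) (use AE_pos ex in auto)
  also have "\<dots> = 1 + (\<integral>\<^sup>+z. (\<integral>\<^sup>+s. ennreal (L * exp (L * s)) * indicator {0..} s * indicator {s<..} z \<partial>lborel) \<partial>M)"
    using emeasure_space_1 by (subst nn_integral_add) simp_all
  also have "(\<integral>\<^sup>+z. (\<integral>\<^sup>+s. ennreal (L * exp (L * s)) * indicator {0..} s * indicator {s<..} z \<partial>lborel) \<partial>M)
     = (\<integral>\<^sup>+s. (\<integral>\<^sup>+z. ennreal (L * exp (L * s)) * indicator {0..} s * indicator {s<..} z \<partial>M) \<partial>lborel)"
    by (rule Fubini'[symmetric]) measurable
  also have "\<dots> = (\<integral>\<^sup>+s. ennreal (indicator {0..} s *\<^sub>R (L * (exp (L * s) * (1 - cdf M s)))) \<partial>lborel)"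
  proof (rule nn_integral_cong)
    fix s
    have "(\<integral>\<^sup>+z. ennreal (L * exp (L * s)) * indicator {0..} s * indicator {s<..} z \<partial>M)
        = ennreal (L * exp (L * s)) * indicator {0..} s * ennreal (1 - cdf M s)"
      by (simp add: nn_integral_cmult_indicator tail)
    then show "(\<integral>\<^sup>+z. ennreal (L * exp (L * s)) * indicator {0..} s * indicator {s<..} z \<partial>M)
        = ennreal (indicator {0..} s *\<^sub>R (L * (exp (L * s) * (1 - cdf M s))))"
      using \<open>L > 0\<close> cdf_le by (simp add: ennreal_mult mult.assoc split: split_indicator)
  qed
  also have "\<dots> = ennreal (LBINT s:{0..}. L * (exp (L * s) * (1 - cdf M s)))"
    unfolding set_lebesgue_integral_def
  proof (rule nn_integral_eq_integral)
    show "integrable lborel (\<lambda>s. indicat_real {0..} s *\<^sub>R (L * (exp (L * s) * (1 - cdf M s))))"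
      using set_integrable_mult_right[of L lborel "{0..}", OF int] by (simp add: set_integrable_def)
  qed (use \<open>L > 0\<close> cdf_le in auto)
  also have "\<dots> = ennreal (L * ?I)" by simp
  also have "1 + ennreal (L * ?I) = ennreal (1 + L * ?I)"
    using I_nonneg \<open>L > 0\<close> by (subst ennreal_1[symmetric], subst ennreal_plus[symmetric]) auto
  finally have nn: "(\<integral>\<^sup>+z. ennreal (exp (L * z)) \<partial>M) = ennreal (1 + L * ?I)" .
  have "has_bochner_integral M (\<lambda>z. exp (L * z)) (1 + L * ?I)"
    using nn I_nonneg \<open>L > 0\<close> by (intro has_bochner_integral_nn_integral) auto
  then show "integrable M (\<lambda>z. exp (L * z))" "expectation (\<lambda>z. exp (L * z)) = 1 + L * ?I"
    by (auto simp: has_bochner_integral_iff)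
qed

section \<open>The risk operator: decomposition and measurability\<close>

locale risk_model =
  fixes \<alpha> lam :: "'i::finite \<Rightarrow> real"
    and p :: "'i \<Rightarrow> 'i \<Rightarrow> real"
    and F :: "'i \<Rightarrow> real \<Rightarrow> real"
    and U :: "'i \<Rightarrow> real \<Rightarrow> real \<Rightarrow> real"
  assumes \<alpha>_pos: "\<And>i. \<alpha> i > 0" and lam_pos: "\<And>i. lam i > 0"
    and p_nonneg: "\<And>i j. p i j \<ge> 0" and p_sum: "\<And>i. (\<Sum>j\<in>UNIV. p i j) = 1"
    and df: "\<And>i. distribution_function (F i)"
    and U_nonneg: "\<And>i u t. u \<ge> 0 \<Longrightarrow> t \<ge> 0 \<Longrightarrow> U i u t \<ge> 0"
    and U_cont: "\<And>i u. u \<ge> 0 \<Longrightarrow> continuous_on {0..} (U i u)"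
    and U_mono: "\<And>i t. t \<ge> 0 \<Longrightarrow> mono_on {0..} (\<lambda>u. U i u t)"
    and U_at_top: "\<And>i u. u \<ge> 0 \<Longrightarrow> filterlim (\<lambda>t. U i u t) at_top at_top"
begin

abbreviation R :: "('i \<Rightarrow> real \<Rightarrow> real) \<Rightarrow> 'i \<Rightarrow> real \<Rightarrow> real" where
  "R \<equiv> risk_operator \<alpha> lam p F U"

definition claim_part :: "('i \<Rightarrow> real \<Rightarrow> real) \<Rightarrow> 'i \<Rightarrow> real \<Rightarrow> real" where
  "claim_part \<phi> i v = (LINT z:{0..v}|interval_measure (F i). \<phi> i (v - z))"

text \<open>The expected value just after the first event, times the total rate
  \<open>\<alpha> i + lam i\<close>, when that event finds the reserve at \<open>v\<close>; a claim
  exceeding \<open>v\<close> contributes 0. Being a function of \<open>v\<close> alone, it keeps the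
  estimates in the reserve apart from the flow \<open>U\<close>.\<close>

definition jump_part :: "('i \<Rightarrow> real \<Rightarrow> real) \<Rightarrow> 'i \<Rightarrow> real \<Rightarrow> real" where
  "jump_part \<phi> i v = lam i * (\<Sum>j\<in>UNIV. p i j * \<phi> j v) + \<alpha> i * claim_part \<phi> i v"

lemma R_eq: "R \<phi> i u = (LBINT t:{0..}. exp (- t * (\<alpha> i + lam i)) * jump_part \<phi> i (U i u t))"
  by (simp add: risk_operator_def jump_part_def claim_part_def)

text \<open>The class on which \<open>R\<close> is iterated. The bounds make all integrals exist;
  conditions are imposed on \<open>{0..}\<close> only, because values at negative arguments are
  arbitrary.\<close>

definition unit_valued :: "('i \<Rightarrow> real \<Rightarrow> real) \<Rightarrow> bool" where
  "unit_valued \<phi> \<longleftrightarrow> (\<forall>i. set_borel_measurable borel {0..} (\<phi> i) \<and> (\<forall>u\<ge>0. 0 \<le> \<phi> i u \<and> \<phi> i u \<le> 1))"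

lemma unit_valuedD:
  assumes "unit_valued \<phi>" "u \<ge> 0"
  shows "0 \<le> \<phi> i u" "\<phi> i u \<le> 1"
  using assms by (auto simp: unit_valued_def)

lemma unit_valued_measurable:
  "unit_valued \<phi> \<Longrightarrow> (\<lambda>u. indicator {0..} u * \<phi> i u) \<in> borel_measurable borel"
  by (simp add: unit_valued_def set_borel_measurable_def)

lemma total_rate_pos: "\<alpha> i + lam i > 0"
  using \<alpha>_pos[of i] lam_pos[of i] by simp

lemma real_distribution_claims: "real_distribution (interval_measure (F i))"
  by (rule real_distribution_distribution_function[OF df])

text \<open>With the indicator of \<open>{0..v}\<close> split into two factors, \<phi> enters only
  through its truncation to \<open>{0..}\<close>, which is Borel on the whole line.\<close>

lemma claim_part_eq:
  "claim_part \<phi> i v = (LINT z|interval_measure (F i). indicator {0..} z * (indicator {0..} (v - z) * \<phi> i (v - z)))"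
  unfolding claim_part_def set_lebesgue_integral_def
  by (intro Bochner_Integration.integral_cong) (auto split: split_indicator)

lemma claim_part_integrable:
  assumes "unit_valued \<phi>"
  shows "set_integrable (interval_measure (F i)) {0..v} (\<lambda>z. \<phi> i (v - z))"
proof -
  interpret real_distribution "interval_measure (F i)" by (rule real_distribution_claims)
  have eq: "(\<lambda>z. indicator {0..v} z *\<^sub>R \<phi> i (v - z)) =
      (\<lambda>z. indicator {0..} z * (indicator {0..} (v - z) * \<phi> i (v - z)))"
    by (auto split: split_indicator)
  have "(\<lambda>z. indicator {0..} (v - z) * \<phi> i (v - z)) \<in> borel_measurable borel"
    using measurable_compose[OF _ unit_valued_measurable[OF assms, of i], of "\<lambda>z. v - z" borel] by simp
  then have "integrable (interval_measure (F i)) (\<lambda>z. indicator {0..} z * (indicator {0..} (v - z) * \<phi> i (v - z)))"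
    using unit_valuedD[OF assms] by (intro integrable_const_bound[of _ 1]) (auto split: split_indicator)
  then show ?thesis
    unfolding set_integrable_def eq .
qed

lemma claim_part_measurable:
  assumes "unit_valued \<phi>"
  shows "claim_part \<phi> i \<in> borel_measurable borel"
proof -
  interpret real_distribution "interval_measure (F i)" by (rule real_distribution_claims)
  have "(\<lambda>x. indicator {0..} (fst x - snd x) * \<phi> i (fst x - snd x)) \<in> borel_measurable (borel \<Otimes>\<^sub>M borel)"
    using measurable_compose[OF _ unit_valued_measurable[OF assms, of i], of "\<lambda>x. fst x - snd x" "borel \<Otimes>\<^sub>M borel"]
    by simp
  then have "(\<lambda>(v, z). indicator {0..} z * (indicator {0..} (v - z) * \<phi> i (v - z)))
      \<in> borel_measurable (borel \<Otimes>\<^sub>M interval_measure (F i))"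
    by (simp add: case_prod_beta)
  then have "(\<lambda>v. LINT z|interval_measure (F i). indicator {0..} z * (indicator {0..} (v - z) * \<phi> i (v - z)))
      \<in> borel_measurable borel"
    by (rule borel_measurable_lebesgue_integral)
  then show ?thesis
    by (simp add: claim_part_eq[abs_def])
qed

lemma claim_part_mono:
  assumes "unit_valued \<phi>" "unit_valued \<psi>"
    and "\<And>w. 0 \<le> w \<Longrightarrow> w \<le> v \<Longrightarrow> \<phi> i w \<le> \<psi> i w"
  shows "claim_part \<phi> i v \<le> claim_part \<psi> i v"
  unfolding claim_part_def
  by (intro set_integral_mono claim_part_integrable assms) auto

text \<open>Raising \<open>v\<close> increases the argument \<open>v - z\<close> and also enlarges
  the domain of integration; the latter helps because \<phi> is nonnegative.\<close>

lemma claim_part_mono_on: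
  assumes \<phi>: "unit_valued \<phi>" and mono: "mono_on {0..} (\<phi> i)"
  shows "mono_on {0..} (claim_part \<phi> i)"
proof (rule mono_onI)
  fix v w :: real
  assume "v \<in> {0..}" "w \<in> {0..}" "v \<le> w"
  then show "claim_part \<phi> i v \<le> claim_part \<phi> i w"
    unfolding claim_part_def set_lebesgue_integral_def
    using claim_part_integrable[OF \<phi>, of i] unit_valuedD[OF \<phi>] mono
    by (intro integral_mono) (auto simp: set_integrable_def split: split_indicator intro!: mono_onD[OF mono])
qed

lemma claim_part_nonneg:
  assumes "unit_valued \<phi>"
  shows "0 \<le> claim_part \<phi> i v"
  unfolding claim_part_def set_lebesgue_integral_def
  using unit_valuedD[OF assms] by (intro integral_nonneg_AE) (auto split: split_indicator)

text \<open>Claims outside \<open>{0..v}\<close> contribute 0, which is at most \<open>C\<close> by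
  \<open>0 \<le> C\<close>, so the comparison is with a constant under a probability
  measure.\<close>

lemma claim_part_le:
  assumes "unit_valued \<phi>" "0 \<le> C" and "\<And>w. 0 \<le> w \<Longrightarrow> w \<le> v \<Longrightarrow> \<phi> i w \<le> C"
  shows "claim_part \<phi> i v \<le> C"
proof -
  interpret real_distribution "interval_measure (F i)" by (rule real_distribution_claims)
  have "claim_part \<phi> i v \<le> (LINT z|interval_measure (F i). C)"
    unfolding claim_part_def set_lebesgue_integral_def
    using claim_part_integrable[OF assms(1), of i v] assms(2,3)
    by (intro integral_mono) (auto simp: set_integrable_def split: split_indicator)
  also have "\<dots> = C"
    using prob_space by simp
  finally show ?thesis .
qed

lemma claim_part_diff:
  assumes "unit_valued \<phi>" "unit_valued \<psi>"
  shows "claim_part (\<lambda>i u. \<phi> i u - \<psi> i u) i v = claim_part \<phi> i v - claim_part \<psi> i v"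
  unfolding claim_part_def by (intro set_integral_diff claim_part_integrable assms)

lemma claim_part_LIMSEQ:
  assumes "\<And>k. unit_valued (\<phi>k k)" "unit_valued \<phi>"
    and lim: "\<And>w. w \<ge> 0 \<Longrightarrow> (\<lambda>k. \<phi>k k i w) \<longlonglongrightarrow> \<phi> i w"
  shows "(\<lambda>k. claim_part (\<phi>k k) i v) \<longlonglongrightarrow> claim_part \<phi> i v"
  unfolding claim_part_def set_lebesgue_integral_def
proof (rule integral_dominated_convergence[where w = "\<lambda>_. 1"])
  interpret real_distribution "interval_measure (F i)" by (rule real_distribution_claims)
  show "integrable (interval_measure (F i)) (\<lambda>_. 1 :: real)"
    by simp
  show "AE z in interval_measure (F i). (\<lambda>k. indicator {0..v} z *\<^sub>R \<phi>k k i (v - z)) \<longlonglongrightarrow> indicator {0..v} z *\<^sub>R \<phi> i (v - z)"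
    using lim by (auto split: split_indicator)
  show "AE z in interval_measure (F i). norm (indicator {0..v} z *\<^sub>R \<phi>k k i (v - z)) \<le> 1" for k
    using unit_valuedD[OF assms(1)] by (auto split: split_indicator)
qed (use claim_part_integrable assms in \<open>auto simp: set_integrable_def\<close>)

lemma jump_part_measurable:
  assumes "unit_valued \<phi>"
  shows "(\<lambda>v. indicator {0..} v * jump_part \<phi> i v) \<in> borel_measurable borel"
proof -
  have "(\<lambda>v. indicator {0..} v * jump_part \<phi> i v) =
     (\<lambda>v. lam i * (\<Sum>j\<in>UNIV. p i j * (indicator {0..} v * \<phi> j v)) + \<alpha> i * (indicator {0..} v * claim_part \<phi> i v))"
    by (auto simp: jump_part_def split: split_indicator)
  moreover have "\<dots> \<in> borel_measurable borel"
    using unit_valued_measurable[OF assms] claim_part_measurable[OF assms] by measurable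
  ultimately show ?thesis by simp
qed

lemma jump_part_mono:
  assumes "unit_valued \<phi>" "unit_valued \<psi>" "v \<ge> 0"
    and "\<And>j w. 0 \<le> w \<Longrightarrow> \<phi> j w \<le> \<psi> j w"
  shows "jump_part \<phi> i v \<le> jump_part \<psi> i v"
  unfolding jump_part_def using assms \<alpha>_pos[of i] lam_pos[of i]
  by (intro add_mono mult_left_mono sum_mono claim_part_mono p_nonneg) (auto simp: less_imp_le)

lemma jump_part_mono_on:
  assumes \<phi>: "unit_valued \<phi>" and mono: "\<And>j. mono_on {0..} (\<phi> j)"
  shows "mono_on {0..} (jump_part \<phi> i)"
  unfolding jump_part_def using \<alpha>_pos[of i] lam_pos[of i]
  by (intro mono_onI add_mono mult_left_mono sum_mono p_nonneg mono_onD[OF claim_part_mono_on[OF \<phi> mono]] mono_onD[OF mono])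
    (auto simp: less_imp_le)

text \<open>Two constants are kept apart: a change of state sees \<phi> at \<open>v\<close> only,
  whereas a claim may bring the reserve down to any level in \<open>{0..v}\<close>. For large
  \<open>v\<close> only the first bound can be improved.\<close>

lemma jump_part_le:
  assumes "unit_valued \<phi>" "0 \<le> C"
    and "\<And>j. \<phi> j v \<le> D" and "\<And>w. 0 \<le> w \<Longrightarrow> w \<le> v \<Longrightarrow> \<phi> i w \<le> C"
  shows "jump_part \<phi> i v \<le> lam i * D + \<alpha> i * C"
proof -
  have "(\<Sum>j\<in>UNIV. p i j * \<phi> j v) \<le> (\<Sum>j\<in>UNIV. p i j * D)"
    using assms(3) by (intro sum_mono mult_left_mono p_nonneg)
  also have "\<dots> = D"
    by (simp add: p_sum flip: sum_distrib_right)
  finally show ?thesis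
    unfolding jump_part_def using \<alpha>_pos[of i] lam_pos[of i] claim_part_le[OF assms(1,2,4)]
    by (intro add_mono mult_left_mono) (auto simp: less_imp_le)
qed

lemma jump_part_bounds:
  assumes "unit_valued \<phi>" "v \<ge> 0"
  shows "0 \<le> jump_part \<phi> i v" "jump_part \<phi> i v \<le> \<alpha> i + lam i"
proof -
  show "0 \<le> jump_part \<phi> i v"
    unfolding jump_part_def using \<alpha>_pos[of i] lam_pos[of i] p_nonneg unit_valuedD[OF assms] claim_part_nonneg[OF assms(1)]
    by (intro add_nonneg_nonneg mult_nonneg_nonneg sum_nonneg) (auto simp: less_imp_le)
  show "jump_part \<phi> i v \<le> \<alpha> i + lam i"
    using jump_part_le[OF assms(1), of 1 v 1 i] unit_valuedD[OF assms(1)] assms(2) by simp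
qed

lemma jump_part_diff:
  assumes "unit_valued \<phi>" "unit_valued \<psi>"
  shows "jump_part (\<lambda>i u. \<phi> i u - \<psi> i u) i v = jump_part \<phi> i v - jump_part \<psi> i v"
  by (simp add: jump_part_def claim_part_diff[OF assms] algebra_simps sum_subtractf)

lemma jump_part_LIMSEQ:
  assumes "\<And>k. unit_valued (\<phi>k k)" "unit_valued \<phi>" "v \<ge> 0"
    and lim: "\<And>j w. w \<ge> 0 \<Longrightarrow> (\<lambda>k. \<phi>k k j w) \<longlonglongrightarrow> \<phi> j w"
  shows "(\<lambda>k. jump_part (\<phi>k k) i v) \<longlonglongrightarrow> jump_part \<phi> i v"
  unfolding jump_part_def
  by (intro tendsto_intros lim claim_part_LIMSEQ assms)

text \<open>Extending \<open>U\<close> by its boundary values makes the integrand measurable on the whole plane.\<close>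

lemma U_extended_measurable:
  "(\<lambda>(u, t). U i (max 0 u) (max 0 t)) \<in> borel_measurable (borel \<Otimes>\<^sub>M borel)"
proof (rule borel_measurable_pair_continuous_snd)
  show "(\<lambda>u. U i (max 0 u) (max 0 t)) \<in> borel_measurable borel" for t
    by (intro borel_measurable_mono monoI mono_onD[OF U_mono]) auto
  fix u t :: real
  have "continuous_on UNIV (\<lambda>t. U i (max 0 u) (max 0 t))"
    by (rule continuous_on_compose2[OF U_cont]) (auto intro!: continuous_intros)
  then show "isCont (\<lambda>t. U i (max 0 u) (max 0 t)) t"
    by (simp add: continuous_on_eq_continuous_at)
qed

lemma R_integrand_measurable:
  assumes "unit_valued \<phi>"
  shows "(\<lambda>(u, t). indicator {0..} t * (exp (- t * (\<alpha> i + lam i)) * jump_part \<phi> i (U i (max 0 u) (max 0 t))))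
    \<in> borel_measurable (borel \<Otimes>\<^sub>M borel)"
proof -
  have "(\<lambda>x. U i (max 0 (fst x)) (max 0 (snd x))) \<in> borel_measurable (borel \<Otimes>\<^sub>M borel)"
    using U_extended_measurable[of i] by (simp add: case_prod_beta)
  \<comment> \<open>The truncating indicator of \<open>jump_part_measurable\<close> equals 1 here,
    since the extended \<open>U\<close> is nonnegative.\<close>
  from measurable_compose[OF this jump_part_measurable[OF assms, of i]]
  have [measurable]: "(\<lambda>x. jump_part \<phi> i (U i (max 0 (fst x)) (max 0 (snd x)))) \<in> borel_measurable (borel \<Otimes>\<^sub>M borel)"
    by (simp add: U_nonneg)
  show ?thesis
    unfolding case_prod_beta by measurable
qed

lemma R_integrable:
  assumes "unit_valued \<phi>" "u \<ge> 0"
  shows "set_integrable lborel {0..} (\<lambda>t. exp (- t * (\<alpha> i + lam i)) * jump_part \<phi> i (U i u t))"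
proof (rule set_integrable_bound)
  show "set_integrable lborel {0..} (\<lambda>t. exp (- t * (\<alpha> i + lam i)) * (\<alpha> i + lam i))"
    by (intro set_integrable_mult_left set_integrable_exp_minus_Ici total_rate_pos)
  have "(\<lambda>t. indicator {0..} t * (exp (- t * (\<alpha> i + lam i)) * jump_part \<phi> i (U i (max 0 u) (max 0 t)))) \<in> borel_measurable borel"
    using measurable_compose[OF _ R_integrand_measurable[OF assms(1), of i], of "\<lambda>t. (u, t)" borel] by simp
  also have "(\<lambda>t. indicator {0..} t * (exp (- t * (\<alpha> i + lam i)) * jump_part \<phi> i (U i (max 0 u) (max 0 t))))
     = (\<lambda>t. indicator {0..} t *\<^sub>R (exp (- t * (\<alpha> i + lam i)) * jump_part \<phi> i (U i u t)))"
    using assms(2) by (auto split: split_indicator)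
  finally show "set_borel_measurable lborel {0..} (\<lambda>t. exp (- t * (\<alpha> i + lam i)) * jump_part \<phi> i (U i u t))"
    by (simp add: set_borel_measurable_def)
  show "AE t in lborel. t \<in> {0..} \<longrightarrow> norm (exp (- t * (\<alpha> i + lam i)) * jump_part \<phi> i (U i u t))
      \<le> norm (exp (- t * (\<alpha> i + lam i)) * (\<alpha> i + lam i))"
    using jump_part_bounds[OF assms(1) U_nonneg[OF assms(2)]] total_rate_pos[of i]
    by (intro AE_I2) (auto simp: abs_mult)
qed

section \<open>Monotonicity, bounds, linearity and continuity of the operator\<close>

lemma R_mono:
  assumes "unit_valued \<phi>" "unit_valued \<psi>" "u \<ge> 0"
    and "\<And>j w. 0 \<le> w \<Longrightarrow> \<phi> j w \<le> \<psi> j w"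
  shows "R \<phi> i u \<le> R \<psi> i u"
  unfolding R_eq
  by (intro set_integral_mono R_integrable mult_left_mono jump_part_mono assms U_nonneg) auto

lemma R_mono_on:
  assumes \<phi>: "unit_valued \<phi>" and mono: "\<And>j. mono_on {0..} (\<phi> j)"
  shows "mono_on {0..} (R \<phi> i)"
  unfolding R_eq
  by (intro mono_onI set_integral_mono R_integrable \<phi> mult_left_mono mono_onD[OF jump_part_mono_on[OF \<phi> mono]]
       mono_onD[OF U_mono]) (auto intro: U_nonneg)

lemma R_bounds:
  assumes "unit_valued \<phi>" "u \<ge> 0"
  shows "0 \<le> R \<phi> i u" "R \<phi> i u \<le> 1"
proof -
  show "0 \<le> R \<phi> i u"
    unfolding R_eq set_lebesgue_integral_def
    using jump_part_bounds[OF assms(1) U_nonneg[OF assms(2)]]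
    by (intro integral_nonneg_AE) (auto split: split_indicator)
  have "R \<phi> i u \<le> (LBINT t:{0..}. exp (- t * (\<alpha> i + lam i)) * (\<alpha> i + lam i))"
    unfolding R_eq using jump_part_bounds[OF assms(1) U_nonneg[OF assms(2)]]
    by (intro set_integral_mono R_integrable assms set_integrable_mult_left set_integrable_exp_minus_Ici total_rate_pos) auto
  also have "\<dots> = 1"
    using set_lebesgue_integral_exp_minus_Ici[OF total_rate_pos[of i], of 0] total_rate_pos[of i] by simp
  finally show "R \<phi> i u \<le> 1" .
qed

lemma R_unit_valued:
  assumes "unit_valued \<phi>"
  shows "unit_valued (R \<phi>)"
  unfolding unit_valued_def
proof (intro allI conjI impI)
  fix i
  have "(\<lambda>u. LINT t|lborel. indicator {0..} t * (exp (- t * (\<alpha> i + lam i)) * jump_part \<phi> i (U i (max 0 u) (max 0 t)))) \<in> borel_measurable borel"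
    by (rule lborel.borel_measurable_lebesgue_integral) (use R_integrand_measurable[OF assms, of i] in simp)
  then have "(\<lambda>u. indicator {0..} u *\<^sub>R (LINT t|lborel. indicator {0..} t * (exp (- t * (\<alpha> i + lam i)) * jump_part \<phi> i (U i (max 0 u) (max 0 t))))) \<in> borel_measurable borel"
    by measurable
  moreover have "(\<lambda>u. indicator {0..} u *\<^sub>R (LINT t|lborel. indicator {0..} t * (exp (- t * (\<alpha> i + lam i)) * jump_part \<phi> i (U i (max 0 u) (max 0 t))))) =
    (\<lambda>u. indicator {0..} u *\<^sub>R R \<phi> i u)"
    unfolding R_eq set_lebesgue_integral_def
    by (rule ext) (auto split: split_indicator intro!: Bochner_Integration.integral_cong)
  ultimately show "set_borel_measurable borel {0..} (R \<phi> i)"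
    by (simp add: set_borel_measurable_def)
qed (use R_bounds[OF assms] in auto)

text \<open>Integrability is taken from the two terms separately, as the difference may be negative.
  This turns a difference of two fixed points into a fixed point.\<close>

lemma R_diff:
  assumes "unit_valued \<phi>" "unit_valued \<psi>" "u \<ge> 0"
  shows "R (\<lambda>i u. \<phi> i u - \<psi> i u) i u = R \<phi> i u - R \<psi> i u"
  unfolding R_eq jump_part_diff[OF assms(1,2)] right_diff_distrib
  by (intro set_integral_diff R_integrable assms)

text \<open>Dominated convergence twice: the inner integral is dominated by 1, the outer one by the
  exponential density of rate \<open>\<alpha> i + lam i\<close>.\<close>

lemma R_LIMSEQ:
  assumes "\<And>k. unit_valued (\<phi>k k)" "unit_valued \<phi>" "u \<ge> 0"
    and lim: "\<And>j w. w \<ge> 0 \<Longrightarrow> (\<lambda>k. \<phi>k k j w) \<longlonglongrightarrow> \<phi> j w"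
  shows "(\<lambda>k. R (\<phi>k k) i u) \<longlonglongrightarrow> R \<phi> i u"
  unfolding R_eq set_lebesgue_integral_def
proof (rule integral_dominated_convergence[where w = "\<lambda>t. indicator {0..} t *\<^sub>R (exp (- t * (\<alpha> i + lam i)) * (\<alpha> i + lam i))"])
  show "integrable lborel (\<lambda>t. indicator {0..} t *\<^sub>R (exp (- t * (\<alpha> i + lam i)) * (\<alpha> i + lam i)))"
    using set_integrable_mult_left[of "\<alpha> i + lam i", OF set_integrable_exp_minus_Ici[OF total_rate_pos[of i], of 0]]
    by (simp add: set_integrable_def)
  show "AE t in lborel. (\<lambda>k. indicator {0..} t *\<^sub>R (exp (- t * (\<alpha> i + lam i)) * jump_part (\<phi>k k) i (U i u t)))
     \<longlonglongrightarrow> indicator {0..} t *\<^sub>R (exp (- t * (\<alpha> i + lam i)) * jump_part \<phi> i (U i u t))"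
    using jump_part_LIMSEQ[OF assms(1,2) U_nonneg[OF assms(3)] lim]
    by (intro AE_I2) (auto split: split_indicator intro!: tendsto_mult_left)
  show "AE t in lborel. norm (indicator {0..} t *\<^sub>R (exp (- t * (\<alpha> i + lam i)) * jump_part (\<phi>k k) i (U i u t)))
     \<le> indicator {0..} t *\<^sub>R (exp (- t * (\<alpha> i + lam i)) * (\<alpha> i + lam i))" for k
    using jump_part_bounds[OF assms(1) U_nonneg[OF assms(3)]]
    by (intro AE_I2) (auto split: split_indicator simp: abs_mult)
qed (use R_integrable[OF assms(1,3)] R_integrable[OF assms(2,3)] in \<open>auto simp: set_integrable_def\<close>)

text \<open>The integrand is at most \<open>(\<alpha> i + lam i) * M\<close> times the exponential.
  After time \<open>T\<close> the state-change term is bounded with \<open>M / 2\<close> in place of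
  \<open>M\<close>, which saves \<open>lam i * M / 2\<close>; the subtracted quantity is this saving
  integrated over \<open>{T..}\<close>. The claim term is still bounded with \<open>M\<close>, since
  a claim may return the reserve to a low level.\<close>

lemma R_le_strict:
  assumes "unit_valued \<phi>" "u \<ge> 0" "0 \<le> M" "0 \<le> T"
    and le_M: "\<And>j w. w \<ge> 0 \<Longrightarrow> \<phi> j w \<le> M"
    and le_half: "\<And>j t. t \<ge> T \<Longrightarrow> \<phi> j (U i u t) \<le> M / 2"
  shows "R \<phi> i u \<le> M - M / 2 * (lam i * exp (- T * (\<alpha> i + lam i)) / (\<alpha> i + lam i))"
proof -
  define a where "a = \<alpha> i + lam i"
  have a: "a > 0" unfolding a_def by (rule total_rate_pos)
  let ?e = "\<lambda>t. exp (- t * a)"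
  have int0: "integrable lborel (\<lambda>t. indicator {0..} t * ?e t)"
    and intT: "integrable lborel (\<lambda>t. indicator {T..} t * ?e t)"
    using set_integrable_exp_minus_Ici[OF a, of 0] set_integrable_exp_minus_Ici[OF a, of T]
    by (simp_all add: set_integrable_def)
  have "R \<phi> i u \<le> (LINT t|lborel. (a * M) * (indicator {0..} t * ?e t) - (lam i * M / 2) * (indicator {T..} t * ?e t))"
    unfolding R_eq set_lebesgue_integral_def a_def[symmetric]
  proof (rule integral_mono)
    show "integrable lborel (\<lambda>t. indicator {0..} t *\<^sub>R (?e t * jump_part \<phi> i (U i u t)))"
      using R_integrable[OF assms(1,2), of i] by (simp add: set_integrable_def a_def)
    show "integrable lborel (\<lambda>t. (a * M) * (indicator {0..} t * ?e t) - (lam i * M / 2) * (indicator {T..} t * ?e t))"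
      by (intro Bochner_Integration.integrable_diff integrable_mult_right int0 intT)
    fix t :: real
    consider "t < 0" | "0 \<le> t" "t < T" | "T \<le> t" by linarith
    then show "indicator {0..} t *\<^sub>R (?e t * jump_part \<phi> i (U i u t))
      \<le> (a * M) * (indicator {0..} t * ?e t) - (lam i * M / 2) * (indicator {T..} t * ?e t)"
    proof cases
      case 2
      have "jump_part \<phi> i (U i u t) \<le> lam i * M + \<alpha> i * M"
        using 2 U_nonneg[OF assms(2)] by (intro jump_part_le assms) auto
      then have "?e t * jump_part \<phi> i (U i u t) \<le> ?e t * (a * M)"
        by (intro mult_left_mono) (auto simp: a_def algebra_simps)
      then show ?thesis
        using 2 by (simp add: mult_ac)
    next
      case 3
      have "jump_part \<phi> i (U i u t) \<le> lam i * (M / 2) + \<alpha> i * M"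
        using 3 by (intro jump_part_le assms) auto
      then have "?e t * jump_part \<phi> i (U i u t) \<le> ?e t * (a * M - lam i * M / 2)"
        by (intro mult_left_mono) (auto simp: a_def algebra_simps)
      then show ?thesis
        using 3 \<open>0 \<le> T\<close> by (simp add: algebra_simps)
    qed (use \<open>0 \<le> T\<close> in auto)
  qed
  also have "\<dots> = (a * M) * (LBINT t:{0..}. ?e t) - (lam i * M / 2) * (LBINT t:{T..}. ?e t)"
    using int0 intT by (simp add: set_lebesgue_integral_def)
  also have "\<dots> = M - M / 2 * (lam i * exp (- T * a) / a)"
    unfolding set_lebesgue_integral_exp_minus_Ici[OF a] using a by simp
  finally show ?thesis
    by (simp add: a_def)
qed

text \<open>
  If the supremum \<open>M\<close> of \<open>\<delta>\<close> were positive, then \<open>\<delta> \<le> M / 2\<close> beyond some level \<open>B\<close>; from every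
  starting point the reserve exceeds \<open>B\<close> after one common time, and a change of state occurring
  later than that pushes \<open>\<delta>\<close> below \<open>M\<close> by a uniform amount.
\<close>

lemma fixed_point_vanishing_at_top_eq_0:
  assumes \<delta>: "unit_valued \<delta>"
    and fixed: "\<And>i u. u \<ge> 0 \<Longrightarrow> R \<delta> i u = \<delta> i u"
    and lim: "\<And>i. (\<delta> i \<longlongrightarrow> 0) at_top"
    and "v \<ge> 0"
  shows "\<delta> k v = 0"
proof (rule ccontr)
  assume "\<delta> k v \<noteq> 0"
  then have pos: "\<delta> k v > 0"
    using unit_valuedD(1)[OF \<delta> \<open>v \<ge> 0\<close>, of k] by simp
  define S where "S = {\<delta> i u |i u. u \<ge> 0}"
  define M where "M = Sup S"
  have bdd: "bdd_above S"
    unfolding S_def bdd_above_def using unit_valuedD(2)[OF \<delta>] by blast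
  have le_M: "\<delta> i u \<le> M" if "u \<ge> 0" for i u
    unfolding M_def using that by (intro cSup_upper bdd) (auto simp: S_def)
  have "M > 0"
    using pos le_M[OF \<open>v \<ge> 0\<close>, of k] by linarith
  have "\<forall>\<^sub>F u in at_top. \<forall>i. \<delta> i u < M / 2"
    using lim \<open>M > 0\<close> by (intro eventually_all_finite order_tendstoD(2)) auto
  then obtain B where B: "\<And>i u. u \<ge> B \<Longrightarrow> \<delta> i u < M / 2"
    by (auto simp: eventually_at_top_linorder)
  \<comment> \<open>The waiting time is chosen for the initial reserve 0; monotonicity of
    \<open>U\<close> in \<open>u\<close> makes it serve every \<open>u \<ge> 0\<close>.\<close>
  have "\<forall>\<^sub>F t in at_top. \<forall>i. U i 0 t \<ge> B"
    using U_at_top[of 0] by (intro eventually_all_finite) (auto simp: filterlim_at_top)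
  then obtain T' where T': "\<And>i t. t \<ge> T' \<Longrightarrow> U i 0 t \<ge> B"
    by (auto simp: eventually_at_top_linorder)
  define T where "T = max 0 T'"
  \<comment> \<open>The smallest relative saving of \<open>R_le_strict\<close> over the states; it
    is positive because there are finitely many states.\<close>
  define \<kappa> where "\<kappa> = Min (range (\<lambda>i. lam i * exp (- T * (\<alpha> i + lam i)) / (\<alpha> i + lam i)))"
  have "\<kappa> > 0"
    unfolding \<kappa>_def using lam_pos total_rate_pos by (subst Min_gr_iff) auto
  have \<kappa>_le: "\<kappa> \<le> lam i * exp (- T * (\<alpha> i + lam i)) / (\<alpha> i + lam i)" for i
    unfolding \<kappa>_def by (intro Min_le) auto
  have "\<delta> i u \<le> M - M / 2 * \<kappa>" if "u \<ge> 0" for i u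
  proof -
    have "U i u t \<ge> B" if "t \<ge> T" for t
      using mono_onD[OF U_mono, of t 0 u i] T'[of t i] that \<open>u \<ge> 0\<close> by (auto simp: T_def)
    then have "R \<delta> i u \<le> M - M / 2 * (lam i * exp (- T * (\<alpha> i + lam i)) / (\<alpha> i + lam i))"
      using \<open>M > 0\<close> le_M B that by (intro R_le_strict \<delta>) (auto simp: T_def less_imp_le)
    also have "\<dots> \<le> M - M / 2 * \<kappa>"
      using \<kappa>_le[of i] \<open>M > 0\<close> by (intro diff_left_mono mult_left_mono) auto
    finally show ?thesis
      using fixed[OF that] by simp
  qed
  \<comment> \<open>The improved bound holds on all of \<open>S\<close>, hence for its supremum,
    which is impossible when \<open>M\<close> and \<kappa> are positive.\<close>
  then have "M \<le> M - M / 2 * \<kappa>"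
    unfolding M_def using \<open>v \<ge> 0\<close> by (intro cSup_least) (auto simp: S_def M_def)
  then show False
    using \<open>M > 0\<close> \<open>\<kappa> > 0\<close> by (simp add: mult_le_0_iff)
qed

section \<open>Iterates of the operator and their limits\<close>

lemma unit_valued_iterates: "unit_valued \<phi> \<Longrightarrow> unit_valued ((R ^^ k) \<phi>)"
  by (induction k) (auto intro: R_unit_valued)

lemma iterates_mono:
  assumes "unit_valued \<phi>" "unit_valued \<psi>"
    and "\<And>j w. 0 \<le> w \<Longrightarrow> \<phi> j w \<le> \<psi> j w" "u \<ge> 0"
  shows "(R ^^ k) \<phi> i u \<le> (R ^^ k) \<psi> i u"
  using \<open>u \<ge> 0\<close> by (induction k arbitrary: i u) (auto intro!: R_mono unit_valued_iterates assms)

lemma iterates_mono_on: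
  assumes "unit_valued \<phi>" "\<And>j. mono_on {0..} (\<phi> j)"
  shows "mono_on {0..} ((R ^^ k) \<phi> i)"
  by (induction k arbitrary: i) (auto intro!: R_mono_on unit_valued_iterates assms)

text \<open>Placing the extra application of \<open>R\<close> innermost reduces the claim to
  monotonicity of \<open>R ^^ k\<close>, applied to \<open>R \<phi>\<close> and \<phi>.\<close>

lemma iterates_decseq:
  assumes "unit_valued \<phi>" "\<And>j w. 0 \<le> w \<Longrightarrow> R \<phi> j w \<le> \<phi> j w" "u \<ge> 0"
  shows "decseq (\<lambda>k. (R ^^ k) \<phi> i u)"
proof (rule decseq_SucI)
  show "(R ^^ Suc k) \<phi> i u \<le> (R ^^ k) \<phi> i u" for k
    unfolding funpow_Suc_right o_def by (intro iterates_mono R_unit_valued assms)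
qed

lemma iterates_incseq:
  assumes "unit_valued \<phi>" "\<And>j w. 0 \<le> w \<Longrightarrow> \<phi> j w \<le> R \<phi> j w" "u \<ge> 0"
  shows "incseq (\<lambda>k. (R ^^ k) \<phi> i u)"
proof (rule incseq_SucI)
  show "(R ^^ k) \<phi> i u \<le> (R ^^ Suc k) \<phi> i u" for k
    unfolding funpow_Suc_right o_def by (intro iterates_mono R_unit_valued assms)
qed

text \<open>By \<open>R_LIMSEQ\<close> the shifted sequence converges to \<open>R \<psi>\<close>,
  and as a shift it also converges to \<psi>. Measurability and bounds survive pointwise
  limits.\<close>

lemma iterates_limit_fixed_point:
  assumes \<phi>: "unit_valued \<phi>"
    and lim: "\<And>i u. u \<ge> 0 \<Longrightarrow> (\<lambda>k. (R ^^ k) \<phi> i u) \<longlonglongrightarrow> \<psi> i u"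
  shows "unit_valued \<psi>" and "\<And>i u. u \<ge> 0 \<Longrightarrow> R \<psi> i u = \<psi> i u"
proof -
  have it: "unit_valued ((R ^^ k) \<phi>)" for k
    by (rule unit_valued_iterates[OF \<phi>])
  show \<psi>: "unit_valued \<psi>"
    unfolding unit_valued_def
  proof (intro allI conjI impI)
    fix i
    show "set_borel_measurable borel {0..} (\<psi> i)"
      unfolding set_borel_measurable_def
    proof (rule borel_measurable_LIMSEQ_metric)
      show "(\<lambda>u. indicator {0..} u *\<^sub>R (R ^^ k) \<phi> i u) \<in> borel_measurable borel" for k
        using unit_valued_measurable[OF it] by simp
      show "(\<lambda>k. indicator {0..} u *\<^sub>R (R ^^ k) \<phi> i u) \<longlonglongrightarrow> indicator {0..} u *\<^sub>R \<psi> i u" for u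
        using lim[of u i] by (auto split: split_indicator)
    qed
    fix u :: real
    assume u: "u \<ge> 0"
    show "0 \<le> \<psi> i u" "\<psi> i u \<le> 1"
      using unit_valuedD[OF it u] by (auto intro!: LIMSEQ_le_const[OF lim[OF u]] LIMSEQ_le_const2[OF lim[OF u]])
  qed
  fix i and u :: real
  assume u: "u \<ge> 0"
  have "(\<lambda>k. (R ^^ Suc k) \<phi> i u) \<longlonglongrightarrow> R \<psi> i u"
    using R_LIMSEQ[OF it \<psi> u lim] by simp
  moreover have "(\<lambda>k. (R ^^ Suc k) \<phi> i u) \<longlonglongrightarrow> \<psi> i u"
    using lim[OF u] by (rule LIMSEQ_Suc)
  ultimately show "R \<psi> i u = \<psi> i u"
    by (rule LIMSEQ_unique)
qed

end

section \<open>The exponential lower bound as a subsolution\<close>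

locale risk_model_lower = risk_model +
  fixes c :: "'a \<Rightarrow> real" and L ustar :: real
  assumes F_0: "\<And>i. F i 0 = 0"
    and c_pos: "\<And>i. c i > 0" and ustar: "ustar \<ge> 0"
    and U_ge: "\<And>i u t. u \<ge> ustar \<Longrightarrow> t \<ge> 0 \<Longrightarrow> U i u t \<ge> u + c i * t"
    and L_pos: "L > 0"
    and tail_integrable: "\<And>i. set_integrable lborel {0..} (\<lambda>z. exp (L * z) * (1 - F i z))"
    and tail_le: "\<And>i. (\<alpha> i / c i) * (LBINT z:{0..}. exp (L * z) * (1 - F i z)) \<le> 1"
begin

lemma phi_lower_mono: "u \<le> v \<Longrightarrow> phi_lower L ustar u \<le> phi_lower L ustar v"
  unfolding phi_lower_def using L_pos by (intro max.mono diff_left_mono) auto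

lemma phi_lower_at_top: "(phi_lower L ustar \<longlongrightarrow> 1) at_top"
proof -
  have "((\<lambda>u. max 0 (1 - exp (- L * (u - ustar)))) \<longlongrightarrow> max 0 (1 - 0)) at_top"
    using L_pos by (intro tendsto_intros) real_asymp
  then show ?thesis
    by (simp add: phi_lower_def[abs_def])
qed

lemma unit_valued_between:
  assumes "\<And>i. set_borel_measurable borel {0..} (\<phi> i)" "between_bounds L ustar \<phi>"
  shows "unit_valued \<phi>"
  using assms unfolding unit_valued_def between_bounds_def phi_lower_def by force

lemma unit_valued_phi_lower: "unit_valued (\<lambda>_. phi_lower L ustar)"
proof (rule unit_valued_between)
  show "set_borel_measurable borel {0..} (phi_lower L ustar)"
    by (intro set_borel_measurable_mono_on_Ici mono_onI phi_lower_mono)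
  show "between_bounds L ustar (\<lambda>_. phi_lower L ustar)"
    by (auto simp: between_bounds_def phi_lower_def)
qed

lemma unit_valued_1: "unit_valued (\<lambda>_ _. 1)"
  by (auto simp: unit_valued_def set_borel_measurable_def)

text \<open>The function \<open>1 - exp (- L * (w - ustar))\<close> lies below
  \<open>phi_lower\<close> for \<open>w \<ge> 0\<close> and is nonpositive for \<open>w < 0\<close>.
  Hence it may be integrated at \<open>w = v - z\<close> over all claims, where it produces the
  exponential moment, and \<open>tail_le\<close> bounds that moment by
  \<open>1 + L * c i / \<alpha> i\<close>.\<close>

lemma claim_part_phi_lower_ge:
  assumes "v \<ge> ustar"
  shows "1 - exp (- L * (v - ustar)) * (1 + L * c i / \<alpha> i) \<le> claim_part (\<lambda>_. phi_lower L ustar) i v"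
proof -
  interpret real_distribution "interval_measure (F i)" by (rule real_distribution_claims)
  have cdf: "cdf (interval_measure (F i)) = F i"
    by (rule cdf_distribution_function[OF df])
  have exp_int: "integrable (interval_measure (F i)) (\<lambda>z. exp (L * z))"
    and exp_eq: "expectation (\<lambda>z. exp (L * z)) = 1 + L * (LBINT z:{0..}. exp (L * z) * (1 - F i z))"
    using exp_moment_tail[OF L_pos, unfolded cdf, OF F_0 tail_integrable] by simp_all
  have AE_pos: "AE z in interval_measure (F i). 0 < z"
  proof (rule AE_I)
    show "emeasure (interval_measure (F i)) {..0} = 0"
      using F_0[of i] cdf by (simp add: cdf_def emeasure_eq_measure fun_eq_iff)
  qed (auto simp: not_less)
  have "(LBINT z:{0..}. exp (L * z) * (1 - F i z)) \<le> c i / \<alpha> i"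
    using tail_le[of i] \<alpha>_pos[of i] c_pos[of i] by (simp add: field_simps)
  then have moment: "expectation (\<lambda>z. exp (L * z)) \<le> 1 + L * c i / \<alpha> i"
    using exp_eq L_pos mult_left_mono[of _ "c i / \<alpha> i" L] by simp
  have "1 - exp (- L * (v - ustar)) * (1 + L * c i / \<alpha> i) \<le> 1 - exp (- L * (v - ustar)) * expectation (\<lambda>z. exp (L * z))"
    using moment by (intro diff_left_mono mult_left_mono) auto
  also have "\<dots> = expectation (\<lambda>z. 1 - exp (- L * (v - ustar)) * exp (L * z))"
    using exp_int prob_space by simp
  also have "\<dots> \<le> claim_part (\<lambda>_. phi_lower L ustar) i v"
    unfolding claim_part_def set_lebesgue_integral_def
  proof (rule integral_mono_AE)
    show "integrable (interval_measure (F i)) (\<lambda>z. indicator {0..v} z *\<^sub>R phi_lower L ustar (v - z))"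
      using claim_part_integrable[OF unit_valued_phi_lower, of i v] by (simp add: set_integrable_def)
    show "AE z in interval_measure (F i). 1 - exp (- L * (v - ustar)) * exp (L * z)
        \<le> indicator {0..v} z *\<^sub>R phi_lower L ustar (v - z)"
      using AE_pos
    proof eventually_elim
      case (elim z)
      have eq: "exp (- L * (v - ustar)) * exp (L * z) = exp (- L * (v - z - ustar))"
        by (simp add: exp_add[symmetric] algebra_simps)
      show ?case
      proof (cases "z \<le> v")
        case True
        then show ?thesis
          unfolding eq using elim by (simp add: phi_lower_def)
      next
        case False
        \<comment> \<open>Here \<open>v - z < 0 \<le> ustar\<close>, so the exponential is at least
          1 and the left side is nonpositive.\<close>
        then have "0 \<le> - L * (v - z - ustar)"
          using L_pos ustar by (simp add: mult_le_0_iff)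
        then show ?thesis
          unfolding eq using False by simp
      qed
    qed
  qed (use exp_int in auto)
  finally show ?thesis .
qed

text \<open>Up to \<open>ustar\<close> the left side is 0. Beyond it, \<open>U i u t\<close> is
  replaced by the line \<open>u + c i * t\<close>, which turns the lower estimate into exponentials
  in \<open>t\<close> that integrate exactly to \<open>1 - E\<close>.\<close>

lemma phi_lower_le_R:
  assumes "u \<ge> 0"
  shows "phi_lower L ustar u \<le> R (\<lambda>_. phi_lower L ustar) i u"
proof (cases "u \<le> ustar")
  case True
  then have "phi_lower L ustar u = 0"
    using L_pos by (simp add: phi_lower_def mult_le_0_iff)
  then show ?thesis
    using R_bounds(1)[OF unit_valued_phi_lower assms] by simp
next
  case False
  define a where "a = \<alpha> i + lam i"
  \<comment> \<open>This constant occurs twice: as the coefficient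
    \<open>lam i + \<alpha> i * (1 + L * c i / \<alpha> i)\<close> from the jump estimate, and as
    the decay rate once \<open>c i * t\<close> enters the exponent. The time integral therefore
    cancels it.\<close>
  define b where "b = a + L * c i"
  define E where "E = exp (- L * (u - ustar))"
  have a: "a > 0" unfolding a_def by (rule total_rate_pos)
  have b: "b > 0" using a L_pos c_pos[of i] by (simp add: b_def add_pos_pos)
  let ?\<phi> = "\<lambda>_ :: 'a. phi_lower L ustar"
  have jump: "a - E * exp (- t * (L * c i)) * b \<le> jump_part ?\<phi> i (U i u t)" if "t \<ge> 0" for t
  proof -
    define v where "v = u + c i * t"
    have v: "v \<ge> ustar" "v \<ge> 0" "v \<le> U i u t"
      using False that c_pos[of i] ustar U_ge[of u t i] by (auto simp: v_def intro: add_increasing2)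
    have Ev: "exp (- L * (v - ustar)) = E * exp (- t * (L * c i))"
      by (simp add: E_def v_def exp_add[symmetric] algebra_simps)
    have "a - E * exp (- t * (L * c i)) * b =
      lam i * (1 - exp (- L * (v - ustar))) + \<alpha> i * (1 - exp (- L * (v - ustar)) * (1 + L * c i / \<alpha> i))"
      using \<alpha>_pos[of i] unfolding Ev a_def b_def by (simp add: field_simps)
    also have "\<dots> \<le> lam i * phi_lower L ustar v + \<alpha> i * claim_part ?\<phi> i v"
      using lam_pos[of i] \<alpha>_pos[of i] claim_part_phi_lower_ge[OF v(1)]
      by (intro add_mono mult_left_mono) (auto simp: phi_lower_def)
    also have "\<dots> = jump_part ?\<phi> i v"
      by (simp add: jump_part_def p_sum flip: sum_distrib_right)
    also have "\<dots> \<le> jump_part ?\<phi> i (U i u t)"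
      using v by (intro mono_onD[OF jump_part_mono_on] unit_valued_phi_lower mono_onI phi_lower_mono) auto
    finally show ?thesis .
  qed
  have "phi_lower L ustar u = 1 - E"
    using False L_pos by (simp add: phi_lower_def E_def mult_le_0_iff)
  also have "\<dots> = a * (LBINT t:{0..}. exp (- t * a)) - E * b * (LBINT t:{0..}. exp (- t * b))"
    unfolding set_lebesgue_integral_exp_minus_Ici[OF a] set_lebesgue_integral_exp_minus_Ici[OF b] using a b by simp
  also have "\<dots> = (LBINT t:{0..}. a * exp (- t * a) - E * b * exp (- t * b))"
    using set_integrable_exp_minus_Ici[OF a, of 0] set_integrable_exp_minus_Ici[OF b, of 0]
    by (subst set_integral_diff) (auto intro!: set_integrable_mult_right)
  also have "\<dots> \<le> R ?\<phi> i u"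
    unfolding R_eq a_def[symmetric]
  proof (rule set_integral_mono)
    show "set_integrable lborel {0..} (\<lambda>t. a * exp (- t * a) - E * b * exp (- t * b))"
      by (intro set_integral_diff set_integrable_mult_right set_integrable_exp_minus_Ici a b)
    show "set_integrable lborel {0..} (\<lambda>t. exp (- t * a) * jump_part ?\<phi> i (U i u t))"
      using R_integrable[OF unit_valued_phi_lower assms, of i] by (simp add: a_def)
    fix t :: real
    assume "t \<in> {0..}"
    have "exp (- t * b) = exp (- t * a) * exp (- t * (L * c i))"
      by (simp add: b_def exp_add[symmetric] algebra_simps)
    then have "a * exp (- t * a) - E * b * exp (- t * b) = exp (- t * a) * (a - E * exp (- t * (L * c i)) * b)"
      by (simp add: algebra_simps)
    also have "\<dots> \<le> exp (- t * a) * jump_part ?\<phi> i (U i u t)"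
      using jump[of t] \<open>t \<in> {0..}\<close> by (intro mult_left_mono) auto
    finally show "a * exp (- t * a) - E * b * exp (- t * b) \<le> exp (- t * a) * jump_part ?\<phi> i (U i u t)" .
  qed
  finally show ?thesis .
qed

section \<open>Coincidence of the upper and lower limits, uniqueness and convergence\<close>

lemma exists_common_limit:
  obtains \<phi> where "unit_valued \<phi>" "\<And>i u. u \<ge> 0 \<Longrightarrow> R \<phi> i u = \<phi> i u"
    "\<And>i u. u \<ge> 0 \<Longrightarrow> (\<lambda>k. (R ^^ k) (\<lambda>_ _. 1) i u) \<longlonglongrightarrow> \<phi> i u"
    "\<And>i u. u \<ge> 0 \<Longrightarrow> (\<lambda>k. (R ^^ k) (\<lambda>_. phi_lower L ustar) i u) \<longlonglongrightarrow> \<phi> i u"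
    "between_bounds L ustar \<phi>"
proof -
  let ?one = "\<lambda>(_ :: 'a) (_ :: real). 1 :: real" and ?low = "\<lambda>_ :: 'a. phi_lower L ustar"
  note one = unit_valued_1 and low = unit_valued_phi_lower
  have dec: "decseq (\<lambda>k. (R ^^ k) ?one i u)" if "u \<ge> 0" for i u
    using that R_bounds(2)[OF one] by (intro iterates_decseq one)
  have inc: "incseq (\<lambda>k. (R ^^ k) ?low i u)" if "u \<ge> 0" for i u
    using that by (intro iterates_incseq low phi_lower_le_R)
  \<comment> \<open>For \<open>u < 0\<close> these limits may fail to exist; only the values at
    \<open>u \<ge> 0\<close> are ever used.\<close>
  define \<phi> where "\<phi> i u = lim (\<lambda>k. (R ^^ k) ?one i u)" for i u
  define \<psi> where "\<psi> i u = lim (\<lambda>k. (R ^^ k) ?low i u)" for i u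
  have \<phi>: "(\<lambda>k. (R ^^ k) ?one i u) \<longlonglongrightarrow> \<phi> i u" if u: "u \<ge> 0" for i u
  proof -
    obtain l where "(\<lambda>k. (R ^^ k) ?one i u) \<longlonglongrightarrow> l"
      by (rule decseq_convergent[OF dec[OF u, of i], of 0])
        (auto intro: unit_valuedD(1)[OF unit_valued_iterates[OF one] u] that)
    then show ?thesis
      unfolding \<phi>_def convergent_LIMSEQ_iff[symmetric] by (rule convergentI)
  qed
  have \<psi>: "(\<lambda>k. (R ^^ k) ?low i u) \<longlonglongrightarrow> \<psi> i u" if u: "u \<ge> 0" for i u
  proof -
    obtain l where "(\<lambda>k. (R ^^ k) ?low i u) \<longlonglongrightarrow> l"
      by (rule incseq_convergent[OF inc[OF u, of i], of 1])
        (auto intro: unit_valuedD(2)[OF unit_valued_iterates[OF low] u] that)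
    then show ?thesis
      unfolding \<psi>_def convergent_LIMSEQ_iff[symmetric] by (rule convergentI)
  qed
  note \<phi>_fixed = iterates_limit_fixed_point[OF one \<phi>] and \<psi>_fixed = iterates_limit_fixed_point[OF low \<psi>]
  have low_le: "phi_lower L ustar u \<le> \<psi> i u" if "u \<ge> 0" for i u
    using incseq_le[OF inc[OF that, of i] \<psi>[OF that, of i], of 0] by simp
  have le: "\<psi> i u \<le> \<phi> i u" if "u \<ge> 0" for i u
    using that by (intro LIMSEQ_le[OF \<psi> \<phi>] exI[of _ 0] allI impI iterates_mono low one)
      (auto simp: phi_lower_def)
  have "\<phi> i u - \<psi> i u = 0" if "u \<ge> 0" for i u
  proof (rule fixed_point_vanishing_at_top_eq_0[where \<delta> = "\<lambda>i u. \<phi> i u - \<psi> i u"])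
    show "unit_valued (\<lambda>i u. \<phi> i u - \<psi> i u)"
      unfolding unit_valued_def
    proof (intro allI conjI impI)
      fix i
      have "(\<lambda>u. indicator {0..} u * \<phi> i u - indicator {0..} u * \<psi> i u) \<in> borel_measurable borel"
        by (intro borel_measurable_diff unit_valued_measurable \<phi>_fixed \<psi>_fixed)
      then show "set_borel_measurable borel {0..} (\<lambda>u. \<phi> i u - \<psi> i u)"
        by (simp add: set_borel_measurable_def right_diff_distrib)
      fix w :: real
      assume w: "w \<ge> 0"
      show "0 \<le> \<phi> i w - \<psi> i w" "\<phi> i w - \<psi> i w \<le> 1"
        using le[OF w, of i] unit_valuedD(2)[OF \<phi>_fixed(1) w, of i] unit_valuedD(1)[OF \<psi>_fixed(1) w, of i] by simp_all
    qed
    show "R (\<lambda>i u. \<phi> i u - \<psi> i u) i w = \<phi> i w - \<psi> i w" if "w \<ge> 0" for i w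
      using that by (simp add: R_diff \<phi>_fixed \<psi>_fixed)
    show "((\<lambda>u. \<phi> i u - \<psi> i u) \<longlongrightarrow> 0) at_top" for i
    proof (rule tendsto_sandwich)
      show "\<forall>\<^sub>F u in at_top. 0 \<le> \<phi> i u - \<psi> i u"
        using eventually_ge_at_top[of 0] by eventually_elim (simp add: le)
      \<comment> \<open>The upper limit is at most 1 and the lower one at least
        \<open>phi_lower\<close>, so the gap is squeezed to 0 at infinity.\<close>
      show "\<forall>\<^sub>F u in at_top. \<phi> i u - \<psi> i u \<le> 1 - phi_lower L ustar u"
        using eventually_ge_at_top[of 0]
        by eventually_elim (intro diff_mono unit_valuedD(2)[OF \<phi>_fixed(1)] low_le)
      show "((\<lambda>u. 1 - phi_lower L ustar u) \<longlongrightarrow> 0) at_top"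
        using tendsto_diff[OF tendsto_const phi_lower_at_top, of 1] by simp
    qed simp
  qed (use that in auto)
  then have eq: "\<psi> i u = \<phi> i u" if "u \<ge> 0" for i u
    using that by (metis eq_iff_diff_eq_0)
  show ?thesis
  proof (rule that[of \<phi>])
    show "between_bounds L ustar \<phi>"
      using low_le eq unit_valuedD(2)[OF \<phi>_fixed(1)] by (auto simp: between_bounds_def)
  qed (use \<phi>_fixed \<phi> \<psi> eq in auto)
qed

text \<open>A sequence started within the bounds stays between the two extremal ones and so shares
  their limit. Uniqueness is the special case in which the start is itself a solution.\<close>

lemma unique_solution_and_convergence:
  "\<exists>\<phi>. admissible_solution \<alpha> lam p F U L ustar \<phi> \<and>
    (\<forall>\<psi>. admissible_solution \<alpha> lam p F U L ustar \<psi> \<longrightarrow> (\<forall>i. \<forall>u\<ge>0. \<psi> i u = \<phi> i u)) \<and>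
    (\<forall>i. \<forall>u\<ge>0.
       decseq (\<lambda>k. approximation \<alpha> lam p F U (\<lambda>_ _. 1) k i u) \<and>
       (\<lambda>k. approximation \<alpha> lam p F U (\<lambda>_ _. 1) k i u) \<longlonglongrightarrow> \<phi> i u) \<and>
    (\<forall>i. \<forall>u\<ge>0.
       incseq (\<lambda>k. approximation \<alpha> lam p F U (\<lambda>_. phi_lower L ustar) k i u) \<and>
       (\<lambda>k. approximation \<alpha> lam p F U (\<lambda>_. phi_lower L ustar) k i u) \<longlonglongrightarrow> \<phi> i u) \<and>
    (\<forall>\<phi>0. (\<forall>i. set_borel_measurable borel {0..} (\<phi>0 i)) \<and> between_bounds L ustar \<phi>0 \<longrightarrow>
       (\<forall>i. \<forall>u\<ge>0. (\<lambda>k. approximation \<alpha> lam p F U \<phi>0 k i u) \<longlonglongrightarrow> \<phi> i u))"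
proof -
  obtain \<phi> where \<phi>: "unit_valued \<phi>" and fixed: "\<And>i u. u \<ge> 0 \<Longrightarrow> R \<phi> i u = \<phi> i u"
    and upper: "\<And>i u. u \<ge> 0 \<Longrightarrow> (\<lambda>k. (R ^^ k) (\<lambda>_ _. 1) i u) \<longlonglongrightarrow> \<phi> i u"
    and lower: "\<And>i u. u \<ge> 0 \<Longrightarrow> (\<lambda>k. (R ^^ k) (\<lambda>_. phi_lower L ustar) i u) \<longlonglongrightarrow> \<phi> i u"
    and bounds: "between_bounds L ustar \<phi>"
    by (rule exists_common_limit) (rule that)
  have any: "(\<lambda>k. (R ^^ k) \<phi>0 i u) \<longlonglongrightarrow> \<phi> i u"
    if "\<And>i. set_borel_measurable borel {0..} (\<phi>0 i)" "between_bounds L ustar \<phi>0" "u \<ge> 0" for \<phi>0 i u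
  proof (rule tendsto_sandwich[OF _ _ lower upper])
    have \<phi>0: "unit_valued \<phi>0"
      using that(1,2) by (rule unit_valued_between)
    show "\<forall>\<^sub>F k in sequentially. (R ^^ k) (\<lambda>_. phi_lower L ustar) i u \<le> (R ^^ k) \<phi>0 i u"
      using that by (intro always_eventually allI iterates_mono unit_valued_phi_lower \<phi>0) (auto simp: between_bounds_def)
    show "\<forall>\<^sub>F k in sequentially. (R ^^ k) \<phi>0 i u \<le> (R ^^ k) (\<lambda>_ _. 1) i u"
      using that by (intro always_eventually allI iterates_mono unit_valued_1 \<phi>0) (auto simp: between_bounds_def)
  qed (use that in auto)
  have "mono_on {0..} (\<phi> i)" for i
  proof (rule mono_onI)
    fix u v :: real
    assume uv: "u \<in> {0..}" "v \<in> {0..}" "u \<le> v"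
    \<comment> \<open>Monotonicity in \<open>u\<close> is inherited from the iterates of the
      constant 1.\<close>
    have "(R ^^ k) (\<lambda>_ _. 1) i u \<le> (R ^^ k) (\<lambda>_ _. 1) i v" for k
      by (rule mono_onD[OF iterates_mono_on[OF unit_valued_1] uv]) (auto intro: mono_onI)
    then show "\<phi> i u \<le> \<phi> i v"
      using uv by (intro LIMSEQ_le[OF upper upper]) auto
  qed
  moreover have "(\<phi> i \<longlongrightarrow> 1) at_top" for i
  proof (rule tendsto_sandwich[OF _ _ phi_lower_at_top tendsto_const])
    show "\<forall>\<^sub>F u in at_top. phi_lower L ustar u \<le> \<phi> i u" "\<forall>\<^sub>F u in at_top. \<phi> i u \<le> 1"
      using bounds by (auto intro!: eventually_at_top_linorderI[of 0] simp: between_bounds_def)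
  qed
  ultimately have "admissible_solution \<alpha> lam p F U L ustar \<phi>"
    using fixed bounds by (simp add: admissible_solution_def risk_solution_def)
  moreover have "\<psi> i u = \<phi> i u" if \<psi>: "admissible_solution \<alpha> lam p F U L ustar \<psi>" and "u \<ge> 0" for \<psi> i u
  proof -
    \<comment> \<open>Admissibility does not mention measurability; it follows from monotonicity of
      the components.\<close>
    have meas: "set_borel_measurable borel {0..} (\<psi> i)" for i
      using \<psi> by (intro set_borel_measurable_mono_on_Ici) (auto simp: admissible_solution_def)
    have bd: "between_bounds L ustar \<psi>"
      using \<psi> by (simp add: admissible_solution_def)
    note unit = unit_valued_between[OF meas bd]
    have "R \<psi> j w = \<psi> j w" if "w \<ge> 0" for j w
      using \<psi> that by (simp add: admissible_solution_def risk_solution_def)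
    \<comment> \<open>The fixed-point equation holds only for \<open>u \<ge> 0\<close>, so \<psi>
      and \<open>R \<psi>\<close> need not be equal as functions. Being both a sub- and a
      supersolution, \<psi> has iterates that are both increasing and decreasing, hence constant at
      each \<open>u \<ge> 0\<close>.\<close>
    then have inc: "incseq (\<lambda>k. (R ^^ k) \<psi> i u)" and dec: "decseq (\<lambda>k. (R ^^ k) \<psi> i u)"
      using \<open>u \<ge> 0\<close> by (auto intro!: iterates_incseq iterates_decseq unit)
    have "(R ^^ k) \<psi> i u = \<psi> i u" for k
      using incseqD[OF inc, of 0 k] decseqD[OF dec, of 0 k] by simp
    then have "(\<lambda>k. \<psi> i u) \<longlonglongrightarrow> \<phi> i u"
      using any[OF meas bd \<open>u \<ge> 0\<close>, of i] by simp
    then show ?thesis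
      using LIMSEQ_unique[OF tendsto_const] by blast
  qed
  moreover have "decseq (\<lambda>k. (R ^^ k) (\<lambda>_ _. 1) i u)" if "u \<ge> 0" for i u
    using that R_bounds(2)[OF unit_valued_1] by (intro iterates_decseq unit_valued_1)
  moreover have "incseq (\<lambda>k. (R ^^ k) (\<lambda>_. phi_lower L ustar) i u)" if "u \<ge> 0" for i u
    using that by (intro iterates_incseq unit_valued_phi_lower phi_lower_le_R)
  ultimately show ?thesis
    unfolding approximation_def using upper lower any by (intro exI[of _ \<phi>] conjI allI impI) blast+
qed

end

theorem theorem7p5:
  fixes \<alpha> lam c :: "'i::finite \<Rightarrow> real"
    and p :: "'i \<Rightarrow> 'i \<Rightarrow> real"
    and F :: "'i \<Rightarrow> real \<Rightarrow> real"
    and rate :: "'i \<Rightarrow> real \<Rightarrow> real"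
    and U :: "'i \<Rightarrow> real \<Rightarrow> real \<Rightarrow> real"
    and L ustar :: real
  assumes "\<And>i. \<alpha> i > 0" and "\<And>i. lam i > 0"
    and "\<And>i j. p i j \<ge> 0" and "\<And>i. p i i = 0" and "\<And>i. (\<Sum>j\<in>UNIV. p i j) = 1"
    and "\<And>i. distribution_function (F i)"
    and "\<And>i z. z \<le> 0 \<Longrightarrow> F i z = 0"
    and "\<And>i. integrable (interval_measure (F i)) (\<lambda>z. z)"
    and "\<And>i. reserve_growth (rate i) (U i)"
    \<comment> \<open>hypothesis (a)\<close>
    and "\<And>i t. t \<ge> 0 \<Longrightarrow> mono_on {0..} (\<lambda>u. U i u t)"
    and "\<And>i u. u \<ge> 0 \<Longrightarrow> mono_on {0..} (\<lambda>t. U i u t)"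
    and "\<And>i u. u \<ge> 0 \<Longrightarrow> filterlim (\<lambda>t. U i u t) at_top at_top"
    and "\<And>i. c i \<ge> 0" and "ustar \<ge> 0"
    and "\<And>i u t. u \<ge> ustar \<Longrightarrow> t \<ge> 0 \<Longrightarrow> U i u t \<ge> u + c i * t"
    \<comment> \<open>hypothesis (b); \<open>c i \<noteq> 0\<close> is implicit in the divisions by \<open>c i\<close>\<close>
    and "\<And>i. c i \<noteq> 0"
    and "\<And>i. \<alpha> i * df_mean (F i) / c i < 1"
    and "L > 0"
    and "\<And>i. set_integrable lborel {0..} (\<lambda>z. exp (L * z) * (1 - F i z))"
    and "\<And>i. (\<alpha> i / c i) * (LBINT z:{0..}. exp (L * z) * (1 - F i z)) \<le> 1"
  shows "\<exists>\<phi>. admissible_solution \<alpha> lam p F U L ustar \<phi> \<and>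
    (\<forall>\<psi>. admissible_solution \<alpha> lam p F U L ustar \<psi> \<longrightarrow> (\<forall>i. \<forall>u\<ge>0. \<psi> i u = \<phi> i u)) \<and>
    (\<forall>i. \<forall>u\<ge>0.
       decseq (\<lambda>k. approximation \<alpha> lam p F U (\<lambda>_ _. 1) k i u) \<and>
       (\<lambda>k. approximation \<alpha> lam p F U (\<lambda>_ _. 1) k i u) \<longlonglongrightarrow> \<phi> i u) \<and>
    (\<forall>i. \<forall>u\<ge>0.
       incseq (\<lambda>k. approximation \<alpha> lam p F U (\<lambda>_. phi_lower L ustar) k i u) \<and>
       (\<lambda>k. approximation \<alpha> lam p F U (\<lambda>_. phi_lower L ustar) k i u) \<longlonglongrightarrow> \<phi> i u) \<and>
    (\<forall>\<phi>0. (\<forall>i. set_borel_measurable borel {0..} (\<phi>0 i)) \<and> between_bounds L ustar \<phi>0 \<longrightarrow>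
       (\<forall>i. \<forall>u\<ge>0. (\<lambda>k. approximation \<alpha> lam p F U \<phi>0 k i u) \<longlonglongrightarrow> \<phi> i u))"
proof -
  have U_props: "U i u t \<ge> 0" "(U i u has_real_derivative rate i (U i u t)) (at t within {0..})"
    if "u \<ge> 0" "t \<ge> 0" for i u t
    using assms(9)[of i] that by (auto simp: reserve_growth_def)
  interpret risk_model_lower \<alpha> lam p F U c L ustar
  proof
    \<comment> \<open>Continuity in time comes from the differential equation for the
      reserve.\<close>
    show "continuous_on {0..} (U i u)" if "u \<ge> 0" for i u
      using U_props(2)[OF that] by (intro DERIV_continuous_on) auto
    show "c i > 0" for i
      using assms(13)[of i] assms(16)[of i] by simp
  qed (use assms U_props in auto)
  show ?thesis
    by (rule unique_solution_and_convergence)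
qed

end
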